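(* Let $X$ be a finite nonempty set of keys, $\Sigma$ a set, $q\ge1$ an integer, $\epsilon\in[0,1)$, $k\in\mathbb{N}$, and let $\mathcal{H}=\{h_x:\Sigma\to[2^q]\}_{x\in X}$ be $(\epsilon,k)$-wise independent, where evaluating any $h_x$ at any point takes time $c$. Let $m\le k$ and let $\sigma:\{0,\dots,q-1\}\times\{0,\dots,m\}\to\Sigma$ be injective and computable in constant time. Then the FlipHash algorithm defined in the context, on input $(x,n)$ with $n\in\{1,\dots,2^q\}$, runs in time $O(mc)$ in the worst case and in time $O(c)$ on average over $x$ drawn uniformly from $X$ (with bounds independent of $n$).
   Context: $[N]=\{0,\dots,N-1\}$; $\oplus$ is bitwise XOR. $a\overset{\epsilon}{\approx}b$ means $b(1-\epsilon)\le a\le b(1+\epsilon)$. $\mathcal{H}$ is $(\epsilon,k)$-wise independent if for all pairwise distinct $\sigma_1,\dots,\sigma_k\in\Sigma$ and all $z_1,\dots,z_k\in[2^q]$, $\Pr_{x\in X}(\bigwedge_{i=1}^k h_x(\sigma_i)=z_i)\overset{\epsilon}{\approx}2^{-qk}$ with $x$ uniform in $X$. Subroutine $\tilde f(x,2^r)$, $r\in\{0,\dots,q\}$: $a= h_x(\sigma(0,0))\bmod 2^r$; $b=\lfloor\log_2 a\rfloor$ if $a>0$, else $b=0$; $c'=h_x(\sigma(b,0))\bmod 2^b$; return $a\oplus c'$. FlipHash on $(x,n)$: let $r=\lceil\log_2 n\rceil$ and $d=\tilde f(x,2^r)$. If $d<n$, return $d$. Otherwise, for $i=1,\dots,m$ in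 order: let $e_i=h_x(\sigma(r-1,i))\bmod 2^r$; if $e_i<2^{r-1}$, return $\tilde f(x,2^{r-1})$; else if $e_i<n$, return $e_i$; else continue. If the loop finishes without returning, return $\tilde f(x,2^{r-1})$.
   Formalization: Σ is assumed to have at least k elements (otherwise (ε,k)-wise independence is vacuous and the average bound fails), the worst-case bound is O(max(1,m)·c) since O(mc) fails for m=0, and c ≥ 1 is assumed so that O(c) absorbs constant-time steps. *)

theory Defs
  imports "HOL-Probability.Probability" "HOL-Library.Monad_Syntax"
begin

unbundle bit_operations_syntax

definition rel_approx :: "real \<Rightarrow> real \<Rightarrow> real \<Rightarrow> bool" where
  "rel_approx \<epsilon> a b \<longleftrightarrow> b * (1 - \<epsilon>) \<le> a \<and> a \<le> b * (1 + \<epsilon>)"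

definition wise_independent ::
  "real \<Rightarrow> nat \<Rightarrow> nat \<Rightarrow> 'x set \<Rightarrow> 's set \<Rightarrow> ('x \<Rightarrow> 's \<Rightarrow> nat) \<Rightarrow> bool" where
  "wise_independent \<epsilon> k q X S h \<longleftrightarrow>
     (\<forall>(s :: nat \<Rightarrow> 's) (z :: nat \<Rightarrow> nat).
        inj_on s {..<k} \<and> s ` {..<k} \<subseteq> S \<and> (\<forall>i<k. z i < 2 ^ q) \<longrightarrow>
        rel_approx \<epsilon> (measure_pmf.prob (pmf_of_set X) {x. \<forall>i<k. h x (s i) = z i})
          (1 / 2 ^ (q * k)))"

text \<open>
  A computation is a result together with the number of time steps spent on producing it.
  The cost model is the usual word-RAM one: every elementary operation on machine words
  (arithmetic, powers of two, integer logarithms, bitwise operations, comparisons) is one step.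
  The hash functions and the indexing function \<sigma> are procedures with their own running times.
\<close>

datatype 'a timed = Timed (result: 'a) (runtime: nat)

definition ret :: "'a \<Rightarrow> 'a timed" where
  "ret v = Timed v 0"

definition step :: "'a \<Rightarrow> 'a timed" where
  "step v = Timed v 1"

definition bind_timed :: "'a timed \<Rightarrow> ('a \<Rightarrow> 'b timed) \<Rightarrow> 'b timed" where
  "bind_timed M f = Timed (result (f (result M))) (runtime M + runtime (f (result M)))"

adhoc_overloading Monad_Syntax.bind \<rightleftharpoons> bind_timed

text \<open>
  The subroutine on \<open>(x, 2 ^ r)\<close>, where \<open>h\<close> is the hash function of the key \<open>x\<close>.
\<close>

definition f_tilde :: "('s \<Rightarrow> nat timed) \<Rightarrow> (nat \<Rightarrow> nat \<Rightarrow> 's timed) \<Rightarrow> nat \<Rightarrow> nat timed" where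
  "f_tilde h \<sigma> r = do {
     s \<leftarrow> \<sigma> 0 0;
     u \<leftarrow> h s;
     M \<leftarrow> step (2 ^ r);
     a \<leftarrow> step (u mod M);
     pos \<leftarrow> step (0 < a);
     b \<leftarrow> step (if pos then nat \<lfloor>log 2 (real a)\<rfloor> else 0);
     s' \<leftarrow> \<sigma> b 0;
     u' \<leftarrow> h s';
     M' \<leftarrow> step (2 ^ b);
     c' \<leftarrow> step (u' mod M');
     step (a XOR c')
   }"

text \<open>The list holds the values of the loop counter that remain to be processed.\<close>

primrec flip_loop ::
  "('s \<Rightarrow> nat timed) \<Rightarrow> (nat \<Rightarrow> nat \<Rightarrow> 's timed) \<Rightarrow> nat \<Rightarrow> nat \<Rightarrow> nat list \<Rightarrow> nat timed" where
  "flip_loop h \<sigma> r n [] = do {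
     r' \<leftarrow> step (r - 1);
     f_tilde h \<sigma> r'
   }"
| "flip_loop h \<sigma> r n (i # is) = do {
     i \<leftarrow> step i;
     r' \<leftarrow> step (r - 1);
     s \<leftarrow> \<sigma> r' i;
     u \<leftarrow> h s;
     M \<leftarrow> step (2 ^ r);
     e \<leftarrow> step (u mod M);
     M' \<leftarrow> step (2 ^ r');
     low \<leftarrow> step (e < M');
     if low then f_tilde h \<sigma> r'
     else do {
       valid \<leftarrow> step (e < n);
       if valid then ret e else flip_loop h \<sigma> r n is
     }
   }"

definition flip_hash ::
  "('s \<Rightarrow> nat timed) \<Rightarrow> (nat \<Rightarrow> nat \<Rightarrow> 's timed) \<Rightarrow> nat \<Rightarrow> nat \<Rightarrow> nat timed" where
  "flip_hash h \<sigma> m n = do {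
     r \<leftarrow> step (nat \<lceil>log 2 (real n)\<rceil>);
     d \<leftarrow> f_tilde h \<sigma> r;
     valid \<leftarrow> step (d < n);
     if valid then ret d else flip_loop h \<sigma> r n [1..<Suc m]
   }"

end

theory Submission
  imports Defs
begin

text \<open>
  An iteration of the loop fails only if bit \<open>r - 1\<close> of the hash value is set, which happens for
  half of the values in \<open>[2 ^ q]\<close>.  By \<open>(\<epsilon>, k)\<close>-wise independence the first \<open>j \<le> m \<le> k\<close> iterations
  all fail with probability at most \<open>(1 + \<epsilon>) / 2 ^ j\<close>, so the expected number of iterations is
  bounded by the geometric series \<open>2 (1 + \<epsilon>) < 4\<close>.
\<close>

section \<open>Cost calculus and integer logarithms\<close>

lemma result_bind_timed [simp]: "result (bind_timed M f) = result (f (result M))"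
  and runtime_bind_timed [simp]:
    "runtime (bind_timed M f) = runtime M + runtime (f (result M))"
  and result_step [simp]: "result (step v) = v"
  and runtime_step [simp]: "runtime (step v) = 1"
  and result_ret [simp]: "result (ret v) = v"
  and runtime_ret [simp]: "runtime (ret v) = 0"
  by (simp_all add: bind_timed_def step_def ret_def)

text \<open>Makes the leading-bit position \<open>b\<close> of a hash value a legal first index of
  \<sigma>, whose values and running time are controlled only below \<open>q\<close>.\<close>

lemma nat_floor_log2_less:
  assumes "0 < a" "a < 2 ^ q"
  shows "nat \<lfloor>log 2 (real a)\<rfloor> < q"
proof -
  have "real a < 2 ^ q"
    using assms(2) by (metis of_nat_less_iff of_nat_numeral of_nat_power)
  then have "log 2 (real a) < real q"
    using assms(1) by (simp add: log_less_iff powr_realpow)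
  moreover have "0 \<le> log 2 (real a)"
    using assms(1) by simp
  ultimately show ?thesis
    by linarith
qed

lemma nat_ceiling_log2_le:
  assumes "1 \<le> n" "n \<le> 2 ^ q"
  shows "nat \<lceil>log 2 (real n)\<rceil> \<le> q"
proof -
  have "real n \<le> 2 ^ q"
    using assms(2) by (metis of_nat_le_iff of_nat_numeral of_nat_power)
  then have "log 2 (real n) \<le> real q"
    using assms(1) by (simp add: log_le_iff powr_realpow)
  then show ?thesis
    by linarith
qed

section \<open>Running times of the subroutine and of the loop\<close>

text \<open>Two evaluations of \<sigma>, two of \<open>h\<close> and seven elementary steps. No
  bound on \<open>r\<close> is assumed: reduction modulo \<open>2 ^ r\<close> never increases a hash
  value, so \<open>a < 2 ^ q\<close> and hence \<open>b < q\<close>.\<close>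

lemma runtime_f_tilde_le:
  assumes h: "\<And>s. s \<in> S \<Longrightarrow> result (h s) < 2 ^ q" "\<And>s. s \<in> S \<Longrightarrow> runtime (h s) \<le> c"
    and \<sigma>: "\<And>i. i < q \<Longrightarrow> result (\<sigma> i 0) \<in> S" "\<And>i. i < q \<Longrightarrow> runtime (\<sigma> i 0) \<le> t"
    and q: "1 \<le> q"
  shows "runtime (f_tilde h \<sigma> r) \<le> 2 * t + 2 * c + 7"
proof -
  define a where "a = result (h (result (\<sigma> 0 0))) mod 2 ^ r"
  define b where "b = (if 0 < a then nat \<lfloor>log 2 (real a)\<rfloor> else 0)"
  have "a < 2 ^ q"
    unfolding a_def using h(1) \<sigma>(1) q by (intro le_less_trans[OF mod_less_eq_dividend]) auto
  then have b: "b < q"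
    using nat_floor_log2_less[of a q] q by (auto simp: b_def)
  have "runtime (f_tilde h \<sigma> r) =
    runtime (\<sigma> 0 0) + runtime (h (result (\<sigma> 0 0))) +
    runtime (\<sigma> b 0) + runtime (h (result (\<sigma> b 0))) + 7"
    by (simp add: f_tilde_def a_def b_def)
  moreover have "runtime (\<sigma> 0 0) \<le> t" "runtime (\<sigma> b 0) \<le> t"
    "runtime (h (result (\<sigma> 0 0))) \<le> c" "runtime (h (result (\<sigma> b 0))) \<le> c"
    using b q \<sigma> h(2) by auto
  ultimately show ?thesis
    by linarith
qed

text \<open>Settles \<open>n = 1\<close>, the case \<open>r = 0\<close>: the first candidate is
  \<open>0 < n\<close>, so the loop, with its index \<open>r - 1\<close>, is never entered.\<close>

lemma result_f_tilde_0: "result (f_tilde h \<sigma> 0) = 0"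
  by (simp add: f_tilde_def)

text \<open>Weaker than actual failure: the test \<open>e < n\<close> is dropped. The event thus
  depends on \<open>n\<close> only through \<open>r\<close>, and its probability can be bounded
  uniformly in \<open>n\<close>.\<close>

definition loop_fails :: "('s \<Rightarrow> nat timed) \<Rightarrow> (nat \<Rightarrow> nat \<Rightarrow> 's timed) \<Rightarrow> nat \<Rightarrow> nat \<Rightarrow> bool" where
  "loop_fails h \<sigma> r i \<longleftrightarrow> 2 ^ (r - 1) \<le> result (h (result (\<sigma> (r - 1) i))) mod 2 ^ r"

text \<open>
  The sum bounds the number of iterations: iteration \<open>j\<close> is reached only if all earlier ones fail.
\<close>

lemma runtime_flip_loop_le:
  assumes "\<And>i. i \<in> set is \<Longrightarrow> runtime (\<sigma> (r - 1) i) \<le> t"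
    and "\<And>i. i \<in> set is \<Longrightarrow> runtime (h (result (\<sigma> (r - 1) i))) \<le> c"
    and f: "runtime (f_tilde h \<sigma> (r - 1)) \<le> A"
  shows "runtime (flip_loop h \<sigma> r n is) \<le>
    A + 1 + (t + c + 7) * (\<Sum>j<length is. of_bool (\<forall>i<j. loop_fails h \<sigma> r (is ! i)))"
  using assms(1,2)
proof (induction "is")
  case Nil
  then show ?case using f by simp
next
  case (Cons a "is")
  let ?N = "\<lambda>js. \<Sum>j<length js. of_bool (\<forall>i<j. loop_fails h \<sigma> r (js ! i)) :: nat"
  have IH: "runtime (flip_loop h \<sigma> r n is) \<le> A + 1 + (t + c + 7) * ?N is"
    using Cons by simp
  have t: "runtime (\<sigma> (r - 1) a) \<le> t" "runtime (h (result (\<sigma> (r - 1) a))) \<le> c"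
    using Cons.prems by auto
  \<comment> \<open>The summand for \<open>j = 0\<close> has a vacuous condition and equals 1; all
    later ones share the factor for \<open>a\<close>.\<close>
  have N: "?N (a # is) = 1 + of_bool (loop_fails h \<sigma> r a) * ?N is"
    by (simp add: sum.lessThan_Suc_shift All_less_Suc2 del: sum.lessThan_Suc)
  show ?case
  proof (cases "loop_fails h \<sigma> r a")
    case True
    \<comment> \<open>Six elementary steps lead up to the test \<open>low\<close>, and the
      comparison with \<open>n\<close> is the seventh. Returning \<open>e\<close> at that point only
      lowers the cost.\<close>
    then have "runtime (flip_loop h \<sigma> r n (a # is)) \<le>
        t + c + 7 + runtime (flip_loop h \<sigma> r n is)"
      using t by (simp add: loop_fails_def)
    also have "\<dots> \<le> A + 1 + (t + c + 7) * ?N (a # is)"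
      unfolding N using IH True by (simp add: algebra_simps)
    finally show ?thesis .
  next
    case False
    then have "runtime (flip_loop h \<sigma> r n (a # is)) \<le> t + c + 7 + A"
      using t f by (simp add: loop_fails_def)
    also have "\<dots> \<le> A + 1 + (t + c + 7) * ?N (a # is)"
      unfolding N using False by simp
    finally show ?thesis .
  qed
qed

section \<open>Probability that successive iterations fail\<close>

text \<open>Subtracting \<open>2 ^ (r - 1)\<close> maps the values with that bit set injectively to the others.\<close>

lemma card_high_bit_le:
  assumes "1 \<le> r"
  shows "2 * card {u \<in> {..<N}. 2 ^ (r - 1) \<le> u mod 2 ^ r} \<le> (N :: nat)"
proof -
  let ?p = "2 ^ (r - 1) :: nat"
  let ?H = "{u \<in> {..<N}. ?p \<le> u mod 2 ^ r}" and ?L = "{u \<in> {..<N}. \<not> ?p \<le> u mod 2 ^ r}"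
  have r: "(2 :: nat) ^ r = 2 * ?p"
    using assms by (cases r) auto
  have "card ?H \<le> card ?L"
  proof (rule card_inj_on_le[where f = "\<lambda>u. u - ?p"])
    have "?p \<le> u" if "?p \<le> u mod 2 ^ r" for u
      using that mod_less_eq_dividend order_trans by blast
    then show "inj_on (\<lambda>u. u - ?p) ?H"
      by (auto simp: inj_on_def) (metis eq_diff_iff)
    show "(\<lambda>u. u - ?p) ` ?H \<subseteq> ?L"
    proof (rule image_subsetI)
      fix u assume "u \<in> ?H"
      then have u: "u < N" "?p \<le> u mod 2 ^ r"
        by auto
      \<comment> \<open>The subtraction is absorbed by the remainder without a borrow, so the
        quotient stays the same and only the bit \<open>r - 1\<close> is cleared.\<close>
      have "u - ?p = (u mod 2 ^ r - ?p) + 2 ^ r * (u div 2 ^ r)"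
        using u(2) mult_div_mod_eq[of "2 ^ r" u] by linarith
      then have "(u - ?p) mod 2 ^ r = (u mod 2 ^ r - ?p) mod 2 ^ r"
        by (metis mod_mult_self2)
      also have "\<dots> = u mod 2 ^ r - ?p"
        by (rule mod_less) (simp add: less_imp_diff_less)
      also have "\<dots> < ?p"
        proof -
        have "u mod 2 ^ r < 2 * ?p"
          unfolding r[symmetric] by simp
        then show ?thesis
          using u(2) by linarith
      qed
      finally show "u - ?p \<in> ?L"
        using u(1) by simp
    qed
  qed auto
  moreover have "card ?H + card ?L = card {..<N}"
  proof -
    have "?H \<union> ?L = {..<N}" "?H \<inter> ?L = {}"
      by blast+
    then show ?thesis
      using card_Un_disjoint[of ?H ?L] by simp
  qed
  ultimately show ?thesis
    by simp
qed

text \<open>Union bound over all tuples \<open>z\<close> in the box \<open>PiE {..<k} B\<close>: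
  each has probability at most \<open>(1 + \<epsilon>) / 2 ^ (q * k)\<close>, and their number is
  the product of the cardinalities.\<close>

lemma wise_independent_prob_le:
  assumes w: "wise_independent \<epsilon> k q X S h"
    and s: "inj_on s {..<k}" "s ` {..<k} \<subseteq> S"
    and B: "\<And>i. i < k \<Longrightarrow> B i \<subseteq> {..<2 ^ q}"
  shows "measure_pmf.prob (pmf_of_set X) {x. \<forall>i<k. h x (s i) \<in> B i} \<le>
    (1 + \<epsilon>) * (\<Prod>i<k. real (card (B i)) / 2 ^ q)"
proof -
  let ?P = "PiE {..<k} B" and ?E = "\<lambda>z. {x. \<forall>i<k. h x (s i) = z i}"
  have fin: "finite ?P"
    using B by (intro finite_PiE) (auto intro: finite_subset)
  have "{x. \<forall>i<k. h x (s i) \<in> B i} \<subseteq> (\<Union>z\<in>?P. ?E z)"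
  proof
    fix x assume "x \<in> {x. \<forall>i<k. h x (s i) \<in> B i}"
    then show "x \<in> (\<Union>z\<in>?P. ?E z)"
      by (intro UN_I[of "restrict (\<lambda>i. h x (s i)) {..<k}"]) auto
  qed
  then have "measure_pmf.prob (pmf_of_set X) {x. \<forall>i<k. h x (s i) \<in> B i} \<le>
      measure_pmf.prob (pmf_of_set X) (\<Union>z\<in>?P. ?E z)"
    by (intro measure_pmf.finite_measure_mono) auto
  also have "\<dots> \<le> (\<Sum>z\<in>?P. measure_pmf.prob (pmf_of_set X) (?E z))"
    using fin by (intro measure_pmf.finite_measure_subadditive_finite) auto
  also have "\<dots> \<le> (\<Sum>z\<in>?P. 1 / 2 ^ (q * k) * (1 + \<epsilon>))"
  proof (rule sum_mono)
    fix z assume "z \<in> ?P"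
    then have "\<forall>i<k. z i < 2 ^ q"
      using B by (force simp: PiE_iff)
    then show "measure_pmf.prob (pmf_of_set X) (?E z) \<le> 1 / 2 ^ (q * k) * (1 + \<epsilon>)"
      using w s unfolding wise_independent_def rel_approx_def by blast
  qed
  also have "\<dots> = (1 + \<epsilon>) * (\<Prod>i<k. real (card (B i)) / 2 ^ q)"
    by (simp add: card_PiE prod_dividef power_mult)
  finally show ?thesis .
qed

text \<open>Independence speaks of exactly \<open>k\<close> distinct points, while the loop uses
  \<open>m \<le> k\<close>; the missing \<open>k - m\<close> points are taken from the rest of
  \<open>S\<close>.\<close>

lemma obtain_inj_extension:
  fixes g :: "nat \<Rightarrow> 's"
  assumes "inj_on g {..<m}" "g ` {..<m} \<subseteq> S" "m \<le> k" "finite S \<longrightarrow> k \<le> card S"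
  obtains s where "inj_on s {..<k}" "s ` {..<k} \<subseteq> S" "\<And>i. i < m \<Longrightarrow> s i = g i"
proof -
  let ?R = "S - g ` {..<m}"
  have "\<exists>T\<subseteq>?R. card T = k - m \<and> finite T"
  proof (cases "finite S")
    case True
    then have "k - m \<le> card ?R"
      using assms by (simp add: card_Diff_subset card_image)
    then show ?thesis
      using True by (metis finite_Diff finite_subset obtain_subset_with_card_n)
  next
    case False
    then have "infinite ?R" by simp
    then show ?thesis
      by (metis infinite_arbitrarily_large)
  qed
  then obtain T where T: "T \<subseteq> ?R" "card T = k - m" "finite T"
    by blast
  then obtain e where e: "bij_betw e {m..<k} T"
    by (metis card_atLeastLessThan finite_atLeastLessThan finite_same_card_bij)
  let ?s = "\<lambda>i. if i < m then g i else e i"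
  have im: "?s i \<in> g ` {..<m}" if "i < m" for i
    using that by simp
  have e': "?s i \<in> T" if "\<not> i < m" "i < k" for i
    using that e by (auto simp: bij_betw_def)
  show thesis
  proof
    show "inj_on ?s {..<k}"
    proof (rule inj_onI)
      fix i j assume "i \<in> {..<k}" "j \<in> {..<k}" and eq: "?s i = ?s j"
      \<comment> \<open>The mixed cases are impossible because \<open>T\<close> avoids the image of
        \<open>g\<close>.\<close>
      then consider "i < m" "j < m" | "\<not> i < m" "\<not> j < m" "i < k" "j < k"
        using im e' T(1) by (metis DiffE lessThan_iff subsetD)
      then show "i = j"
        using eq assms(1) e by cases (auto simp: inj_on_def bij_betw_def)
    qed
    show "?s ` {..<k} \<subseteq> S"
      using im e' T(1) assms(2) by auto
  qed auto
qed

text \<open>After padding to \<open>k\<close> points, each of the first \<open>j\<close> coordinates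
  is confined to at most half of the values, and the others are left free and contribute the factor
  1.\<close>

lemma prob_loop_fails_le:
  fixes \<sigma> :: "nat \<Rightarrow> nat \<Rightarrow> 's timed"
  assumes X: "finite X" "X \<noteq> {}" and \<epsilon>: "0 \<le> \<epsilon>"
    and S: "finite S \<longrightarrow> k \<le> card S"
    and h: "\<And>x s. x \<in> X \<Longrightarrow> s \<in> S \<Longrightarrow> result (h x s) < 2 ^ q"
    and w: "wise_independent \<epsilon> k q X S (\<lambda>x s. result (h x s))"
    and m: "m \<le> k"
    and \<sigma>: "\<And>j. j \<le> m \<Longrightarrow> result (\<sigma> (r - 1) j) \<in> S"
    and inj: "inj_on (\<lambda>j. result (\<sigma> (r - 1) j)) {..m}"
    and r: "1 \<le> r" and j: "j \<le> m"
  shows "measure_pmf.prob (pmf_of_set X) {x. \<forall>i<j. loop_fails (h x) \<sigma> r (Suc i)} \<le>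
    (1 + \<epsilon>) * (1 / 2) ^ j"
proof -
  let ?g = "\<lambda>i. result (\<sigma> (r - 1) (Suc i))"
  let ?p = "pmf_of_set X"
  \<comment> \<open>The shift by \<open>Suc\<close> matches the loop counter, which starts at 1; the
    second index 0 belongs to the subroutine.\<close>
  have "inj_on ?g {..<m}"
    using comp_inj_on[of Suc "{..<m}", OF _ inj_on_subset[OF inj]]
    by (simp add: comp_def image_subset_iff)
  moreover have "?g ` {..<m} \<subseteq> S"
    using \<sigma> by auto
  ultimately obtain s where s: "inj_on s {..<k}" "s ` {..<k} \<subseteq> S" "\<And>i. i < m \<Longrightarrow> s i = ?g i"
    using obtain_inj_extension[OF _ _ m S] by blast
  define H where "H = {u \<in> {..<2 ^ q :: nat}. 2 ^ (r - 1) \<le> u mod 2 ^ r}"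
  define B where "B = (\<lambda>i. if i < j then H else {..<2 ^ q :: nat})"
  \<comment> \<open>Passing to the support is what places the free coordinates in
    \<open>{..<2 ^ q}\<close>: the range of the hash values is known only for keys in
    \<open>X\<close>.\<close>
  have "measure_pmf.prob ?p {x. \<forall>i<j. loop_fails (h x) \<sigma> r (Suc i)} =
      measure_pmf.prob ?p ({x. \<forall>i<j. loop_fails (h x) \<sigma> r (Suc i)} \<inter> set_pmf ?p)"
    by (simp add: measure_Int_set_pmf)
  also have "\<dots> \<le> measure_pmf.prob ?p {x. \<forall>i<k. result (h x (s i)) \<in> B i}"
  proof (rule measure_pmf.finite_measure_mono)
    have "result (h x (s i)) \<in> B i"
      if "x \<in> X" "\<forall>i<j. loop_fails (h x) \<sigma> r (Suc i)" "i < k" for x i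
    proof -
      have "s i \<in> S" using s(2) that(3) by auto
      then have "result (h x (s i)) < 2 ^ q" using h that(1) by blast
      moreover have "loop_fails (h x) \<sigma> r (Suc i)" "s i = ?g i" if "i < j"
        using that \<open>\<forall>i<j. _ i\<close> s(3) j by auto
      ultimately show ?thesis
        by (auto simp: B_def H_def loop_fails_def)
    qed
    then show "{x. \<forall>i<j. loop_fails (h x) \<sigma> r (Suc i)} \<inter> set_pmf ?p \<subseteq>
        {x. \<forall>i<k. result (h x (s i)) \<in> B i}"
      using X by auto
  qed simp
  also have "\<dots> \<le> (1 + \<epsilon>) * (\<Prod>i<k. real (card (B i)) / 2 ^ q)"
    by (rule wise_independent_prob_le[OF w s(1,2)]) (auto simp: B_def H_def)
  also have "\<dots> \<le> (1 + \<epsilon>) * (\<Prod>i<k. if i < j then 1 / 2 else 1)"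
  proof (intro mult_left_mono prod_mono conjI)
    fix i
    have "real (2 * card H) \<le> real (2 ^ q)"
      unfolding H_def by (rule of_nat_mono, rule card_high_bit_le[OF r])
    then have "real (card H) / 2 ^ q \<le> 1 / 2"
      by (simp add: field_simps)
    then show "real (card (B i)) / 2 ^ q \<le> (if i < j then 1 / 2 else 1)"
      by (simp add: B_def)
  qed (use \<epsilon> in auto)
  also have "(\<Prod>i<k. if i < j then 1 / 2 else 1 :: real) = (\<Prod>i<j. 1 / 2)"
    using j m by (intro prod.mono_neutral_cong_right) auto
  finally show ?thesis
    by simp
qed

section \<open>Worst-case and average running time\<close>

lemma sum_half_powers_le: "(\<Sum>j<m. (1 / 2 :: real) ^ j) \<le> 2"
  by (subst sum_gp_strict) simp

theorem theorem2p6: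
  fixes t\<^sub>\<sigma> :: nat
  shows "\<exists>C :: real. \<forall>(X :: 'x set) (S :: 's set) (q :: nat) (\<epsilon> :: real) (k :: nat)
      (h :: 'x \<Rightarrow> 's \<Rightarrow> nat timed) (c :: nat) (m :: nat) (\<sigma> :: nat \<Rightarrow> nat \<Rightarrow> 's timed).
    finite X \<and> X \<noteq> {} \<and> 1 \<le> q \<and> 0 \<le> \<epsilon> \<and> \<epsilon> < 1 \<and>
    (finite S \<longrightarrow> k \<le> card S) \<and>
    (\<forall>x\<in>X. \<forall>s\<in>S. result (h x s) < 2 ^ q) \<and>
    wise_independent \<epsilon> k q X S (\<lambda>x s. result (h x s)) \<and>
    1 \<le> c \<and> (\<forall>x\<in>X. \<forall>s\<in>S. runtime (h x s) \<le> c) \<and>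
    m \<le> k \<and>
    (\<forall>i<q. \<forall>j\<le>m. result (\<sigma> i j) \<in> S \<and> runtime (\<sigma> i j) \<le> t\<^sub>\<sigma>) \<and>
    inj_on (\<lambda>(i, j). result (\<sigma> i j)) ({..<q} \<times> {..m})
    \<longrightarrow>
    (\<forall>n\<in>{1..2 ^ q}.
       (\<forall>x\<in>X. real (runtime (flip_hash (h x) \<sigma> m n)) \<le> C * (real (max 1 m) * real c)) \<and>
       measure_pmf.expectation (pmf_of_set X)
         (\<lambda>x. real (runtime (flip_hash (h x) \<sigma> m n))) \<le> C * real c)"

\<comment> \<open>The constant is
  \<open>(4 * t\<^sub>\<sigma> + 21) + 4 * (t\<^sub>\<sigma> + 8)\<close>: the cost outside the
  iterations plus the cost of one iteration times the bound 4 on their expected number. The worst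
  case fits below it.\<close>
proof (intro exI[of _ "8 * real t\<^sub>\<sigma> + 53"] allI impI ballI)
  fix X :: "'x set" and S :: "'s set" and q :: nat and \<epsilon> :: real and k :: nat
    and h :: "'x \<Rightarrow> 's \<Rightarrow> nat timed" and c m :: nat and \<sigma> :: "nat \<Rightarrow> nat \<Rightarrow> 's timed"
    and n :: nat
  assume asm: "finite X \<and> X \<noteq> {} \<and> 1 \<le> q \<and> 0 \<le> \<epsilon> \<and> \<epsilon> < 1 \<and>
    (finite S \<longrightarrow> k \<le> card S) \<and>
    (\<forall>x\<in>X. \<forall>s\<in>S. result (h x s) < 2 ^ q) \<and>
    wise_independent \<epsilon> k q X S (\<lambda>x s. result (h x s)) \<and>
    1 \<le> c \<and> (\<forall>x\<in>X. \<forall>s\<in>S. runtime (h x s) \<le> c) \<and>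
    m \<le> k \<and>
    (\<forall>i<q. \<forall>j\<le>m. result (\<sigma> i j) \<in> S \<and> runtime (\<sigma> i j) \<le> t\<^sub>\<sigma>) \<and>
    inj_on (\<lambda>(i, j). result (\<sigma> i j)) ({..<q} \<times> {..m})"
  assume n: "n \<in> {1..2 ^ q}"
  define r where "r = nat \<lceil>log 2 (real n)\<rceil>"
  define T where "T = (\<lambda>x. real (runtime (flip_hash (h x) \<sigma> m n)))"
  \<comment> \<open>The conjunct \<open>r \<ge> 1\<close> makes \<open>N\<close> vanish for
    \<open>n = 1\<close>, where no iteration takes place and \<open>prob_loop_fails_le\<close> does
    not apply.\<close>
  define N where
    "N = (\<lambda>x. \<Sum>j<m. of_bool (r \<ge> 1 \<and> (\<forall>i<j. loop_fails (h x) \<sigma> r (Suc i))) :: real)"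
  have X: "finite X" "X \<noteq> {}" and c: "1 \<le> real c" and \<epsilon>: "0 \<le> \<epsilon>" "\<epsilon> < 1"
    using asm by auto
  \<comment> \<open>For \<open>r = 0\<close> the truncated subtraction gives 0, which is below
    \<open>q\<close> by \<open>1 \<le> q\<close>.\<close>
  have r: "r - 1 < q"
  proof -
    have "r \<le> q"
      unfolding r_def using n by (intro nat_ceiling_log2_le) auto
    then show ?thesis
      using asm by linarith
  qed
  have T_le: "T x \<le> (4 * real t\<^sub>\<sigma> + 21) * real c + (real t\<^sub>\<sigma> + 8) * real c * N x"
    if x: "x \<in> X" for x
  proof -
    have f: "runtime (f_tilde (h x) \<sigma> r') \<le> 2 * t\<^sub>\<sigma> + 2 * c + 7" for r'
      using asm x by (intro runtime_f_tilde_le[of S _ q]) auto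
    \<comment> \<open>Two steps of \<open>flip_hash\<close> itself, the first call of the
      subroutine, and at most one more call with its extra step after the loop:
      \<open>2 + 7 + 8 = 17\<close>.\<close>
    have "T x \<le> 4 * t\<^sub>\<sigma> + 4 * c + 17 + (t\<^sub>\<sigma> + c + 7) * N x"
    proof (cases "r = 0")
      case True
      then have "runtime (flip_hash (h x) \<sigma> m n) = 2 + runtime (f_tilde (h x) \<sigma> 0)"
        using n by (simp add: flip_hash_def result_f_tilde_0 flip: r_def)
      then show ?thesis
        using f[of 0] True by (simp add: T_def N_def)
    next
      case False
      let ?L = "runtime (flip_loop (h x) \<sigma> r n [1..<Suc m])"
      have "?L \<le> 2 * t\<^sub>\<sigma> + 2 * c + 7 + 1 + (t\<^sub>\<sigma> + c + 7) *
          (\<Sum>j<length [1..<Suc m]. of_bool (\<forall>i<j. loop_fails (h x) \<sigma> r ([1..<Suc m] ! i)))"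
        using asm x r f by (intro runtime_flip_loop_le) auto
      also have "(\<Sum>j<length [1..<Suc m]. of_bool (\<forall>i<j. loop_fails (h x) \<sigma> r ([1..<Suc m] ! i))) =
          (\<Sum>j<m. of_bool (\<forall>i<j. loop_fails (h x) \<sigma> r (Suc i)) :: nat)"
        by (intro sum.cong) (auto simp del: upt_Suc)
      finally have "real ?L \<le> real (2 * t\<^sub>\<sigma> + 2 * c + 7 + 1 + (t\<^sub>\<sigma> + c + 7) *
          (\<Sum>j<m. of_bool (\<forall>i<j. loop_fails (h x) \<sigma> r (Suc i))))"
        by (rule of_nat_mono)
      also have "\<dots> = 2 * t\<^sub>\<sigma> + 2 * c + 8 + (t\<^sub>\<sigma> + c + 7) * N x"
        using False by (simp add: N_def)
      finally have L: "real ?L \<le> 2 * t\<^sub>\<sigma> + 2 * c + 8 + (t\<^sub>\<sigma> + c + 7) * N x" .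
      have "runtime (flip_hash (h x) \<sigma> m n) \<le> 2 + runtime (f_tilde (h x) \<sigma> r) + ?L"
        by (simp add: flip_hash_def flip: r_def del: upt_Suc)
      then have "T x \<le> 2 + real (runtime (f_tilde (h x) \<sigma> r)) + real ?L"
        unfolding T_def by linarith
      then show ?thesis
        using L f[of r] by linarith
    qed
    also have "\<dots> \<le> (4 * real t\<^sub>\<sigma> + 21) * real c + (real t\<^sub>\<sigma> + 8) * real c * N x"
    \<comment> \<open>Since \<open>c \<ge> 1\<close>, all additive terms are absorbed into multiples
      of \<open>c\<close>.\<close>
    proof (intro add_mono mult_right_mono)
      have tc: "real t\<^sub>\<sigma> \<le> real t\<^sub>\<sigma> * real c"
        using c by (simp add: mult_le_cancel_left1)
      show "real (4 * t\<^sub>\<sigma> + 4 * c + 17) \<le> (4 * real t\<^sub>\<sigma> + 21) * real c"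
        using tc c by (simp add: algebra_simps)
      show "real (t\<^sub>\<sigma> + c + 7) \<le> (real t\<^sub>\<sigma> + 8) * real c"
        using tc c by (simp add: algebra_simps)
      show "0 \<le> N x"
        by (simp add: N_def sum_nonneg)
    qed
    finally show ?thesis .
  qed
  have "T x \<le> (8 * real t\<^sub>\<sigma> + 53) * (real (max 1 m) * real c)" if x: "x \<in> X" for x
  proof -
    let ?M = "real (max 1 m)"
    \<comment> \<open>At most \<open>m\<close> iterations occur; \<open>max 1 m\<close> also covers
      \<open>m = 0\<close>, where the calls of the subroutine remain.\<close>
    have "N x \<le> (\<Sum>j<m. 1)"
      unfolding N_def by (intro sum_mono) auto
    then have "N x \<le> ?M"
      by simp
    then have "(real t\<^sub>\<sigma> + 8) * real c * N x \<le> (real t\<^sub>\<sigma> + 8) * real c * ?M"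
      by (intro mult_left_mono) auto
    moreover have "(4 * real t\<^sub>\<sigma> + 21) * real c * 1 \<le> (4 * real t\<^sub>\<sigma> + 21) * real c * ?M"
      by (intro mult_left_mono) auto
    ultimately have "T x \<le> (5 * real t\<^sub>\<sigma> + 29) * (?M * real c)"
      using T_le[OF x] by (simp add: algebra_simps)
    also have "\<dots> \<le> (8 * real t\<^sub>\<sigma> + 53) * (?M * real c)"
      by (intro mult_right_mono) auto
    finally show ?thesis .
  qed
  moreover have "measure_pmf.expectation (pmf_of_set X) T \<le> (8 * real t\<^sub>\<sigma> + 53) * real c"
  proof -
    let ?E = "measure_pmf.expectation (pmf_of_set X) :: ('x \<Rightarrow> real) \<Rightarrow> real"
    have int: "integrable (measure_pmf (pmf_of_set X)) f" for f :: "'x \<Rightarrow> real"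
      using X by (intro integrable_measure_pmf_finite) simp
    have "?E N = (\<Sum>j<m. ?E (\<lambda>x. of_bool (r \<ge> 1 \<and> (\<forall>i<j. loop_fails (h x) \<sigma> r (Suc i)))))"
      unfolding N_def by (rule Bochner_Integration.integral_sum) (rule int)
    \<comment> \<open>The factor 2 bounds \<open>1 + \<epsilon>\<close>, which makes the sum
      independent of \<epsilon>, \<open>n\<close> and, after summing the series,
      \<open>m\<close>.\<close>
    also have "\<dots> \<le> (\<Sum>j<m. 2 * (1 / 2) ^ j)"
    proof (rule sum_mono)
      fix j assume j: "j \<in> {..<m}"
      let ?A = "{x. \<forall>i<j. loop_fails (h x) \<sigma> r (Suc i)}"
      show "?E (\<lambda>x. of_bool (r \<ge> 1 \<and> (\<forall>i<j. loop_fails (h x) \<sigma> r (Suc i)))) \<le> 2 * (1 / 2) ^ j"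
      proof (cases "r \<ge> 1")
        case True
        then have "?E (\<lambda>x. of_bool (r \<ge> 1 \<and> (\<forall>i<j. loop_fails (h x) \<sigma> r (Suc i)))) =
            ?E (indicator ?A)"
          by (intro Bochner_Integration.integral_cong) (auto simp: indicator_def)
        also have "\<dots> = measure_pmf.prob (pmf_of_set X) ?A"
          by simp
        also have "\<dots> \<le> (1 + \<epsilon>) * (1 / 2) ^ j"
        proof (rule prob_loop_fails_le[where S = S and k = k and q = q and m = m])
          show "inj_on (\<lambda>j. result (\<sigma> (r - 1) j)) {..m}"
            using asm r by (auto simp: inj_on_def)
        qed (use asm r j True in auto)
        also have "\<dots> \<le> 2 * (1 / 2) ^ j"
          using \<epsilon> by (intro mult_right_mono) auto
        finally show ?thesis .
      qed simp
    qed
    also have "\<dots> \<le> 4"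
      using sum_half_powers_le[of m] by (simp flip: sum_distrib_left)
    finally have N4: "?E N \<le> 4" .
    \<comment> \<open>\<open>T_le\<close> holds only on \<open>X\<close>, so monotonicity is used
      almost everywhere.\<close>
    have "?E T \<le> ?E (\<lambda>x. (4 * real t\<^sub>\<sigma> + 21) * real c + (real t\<^sub>\<sigma> + 8) * real c * N x)"
      using T_le X by (intro integral_mono_AE int) (auto simp: AE_measure_pmf_iff)
    also have "\<dots> = (4 * real t\<^sub>\<sigma> + 21) * real c + (real t\<^sub>\<sigma> + 8) * real c * ?E N"
      by (simp add: int)
    also have "\<dots> \<le> (4 * real t\<^sub>\<sigma> + 21) * real c + (real t\<^sub>\<sigma> + 8) * real c * 4"
      using N4 by (intro add_left_mono mult_left_mono) auto
    finally show ?thesis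
      by (simp add: algebra_simps)
  qed
  ultimately show
    "(\<forall>x\<in>X. real (runtime (flip_hash (h x) \<sigma> m n)) \<le>
        (8 * real t\<^sub>\<sigma> + 53) * (real (max 1 m) * real c)) \<and>
     measure_pmf.expectation (pmf_of_set X)
       (\<lambda>x. real (runtime (flip_hash (h x) \<sigma> m n))) \<le> (8 * real t\<^sub>\<sigma> + 53) * real c"
    by (auto simp: T_def)
qed

end
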